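(* Let $k$ be a field, $A$ a $k$-algebra and $B\subseteq A$ a $k$-subalgebra. Then there is an injective Lie algebra map $$\iota:\mathrm{HH}^1(A|B)\hookrightarrow\mathrm{HH}^1(A).$$
   Context: $\mathrm{HH}^1(A)=\mathrm{Der}_k(A)/\mathrm{Inn}_k(A)$, derivations modulo inner derivations, with the commutator bracket. $\mathrm{HH}^1(A|B)=\mathrm{Der}_{B^e}(A)/\mathrm{Inn}_{B^e}(A)$, where $\mathrm{Der}_{B^e}(A)$ (resp. $\mathrm{Inn}_{B^e}(A)$) is the set of $k$-derivations (resp. inner derivations) $A\to A$ that are $B$-bimodule homomorphisms, equivalently vanish on $B$; its bracket is also induced by the commutator. The map $\iota$ is the one sending the class of a derivation $f\in\mathrm{Der}_{B^e}(A)$ to the class of $f$ in $\mathrm{HH}^1(A)$. *)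

theory Defs
  imports "HOL-Algebra.Module" "HOL-Algebra.QuotRing" "HOL-Algebra.Subrings"
begin

text \<open>
  The library locale \<open>algebra\<close> forces the algebra to be commutative; the following is its
  noncommutative version (associative and unital, the zero algebra being allowed).
\<close>

locale assoc_algebra = module R M + ring M for R (structure) and M (structure) +
  assumes smult_mult_left:
    "\<lbrakk>c \<in> carrier R; x \<in> carrier M; y \<in> carrier M\<rbrakk> \<Longrightarrow>
      (c \<odot>\<^bsub>M\<^esub> x) \<otimes>\<^bsub>M\<^esub> y = c \<odot>\<^bsub>M\<^esub> (x \<otimes>\<^bsub>M\<^esub> y)"
  and smult_mult_right:
    "\<lbrakk>c \<in> carrier R; x \<in> carrier M; y \<in> carrier M\<rbrakk> \<Longrightarrow>
      x \<otimes>\<^bsub>M\<^esub> (c \<odot>\<^bsub>M\<^esub> y) = c \<odot>\<^bsub>M\<^esub> (x \<otimes>\<^bsub>M\<^esub> y)"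

text \<open>Subalgebras contain the unit of the ambient algebra (this is part of \<open>subring\<close>).\<close>

definition is_subalgebra ::
    "('c, 'r) ring_scheme \<Rightarrow> ('c, 'a, 'm) module_scheme \<Rightarrow> 'a set \<Rightarrow> bool"
  where "is_subalgebra R M B \<longleftrightarrow> subring B M \<and> submodule B R M"

text \<open>
  A Lie algebra is a record of type \<open>module\<close> whose field \<open>mult\<close> is the Lie bracket; the field
  \<open>one\<close> is ignored.
\<close>

locale lie_algebra = module R L for R (structure) and L (structure) +
  assumes bracket_closed:
    "\<lbrakk>x \<in> carrier L; y \<in> carrier L\<rbrakk> \<Longrightarrow> x \<otimes>\<^bsub>L\<^esub> y \<in> carrier L"
  and bracket_add_left:
    "\<lbrakk>x \<in> carrier L; y \<in> carrier L; z \<in> carrier L\<rbrakk> \<Longrightarrow>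
      (x \<oplus>\<^bsub>L\<^esub> y) \<otimes>\<^bsub>L\<^esub> z = x \<otimes>\<^bsub>L\<^esub> z \<oplus>\<^bsub>L\<^esub> y \<otimes>\<^bsub>L\<^esub> z"
  and bracket_add_right:
    "\<lbrakk>x \<in> carrier L; y \<in> carrier L; z \<in> carrier L\<rbrakk> \<Longrightarrow>
      x \<otimes>\<^bsub>L\<^esub> (y \<oplus>\<^bsub>L\<^esub> z) = x \<otimes>\<^bsub>L\<^esub> y \<oplus>\<^bsub>L\<^esub> x \<otimes>\<^bsub>L\<^esub> z"
  and bracket_smult_left:
    "\<lbrakk>c \<in> carrier R; x \<in> carrier L; y \<in> carrier L\<rbrakk> \<Longrightarrow>
      (c \<odot>\<^bsub>L\<^esub> x) \<otimes>\<^bsub>L\<^esub> y = c \<odot>\<^bsub>L\<^esub> (x \<otimes>\<^bsub>L\<^esub> y)"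
  and bracket_smult_right:
    "\<lbrakk>c \<in> carrier R; x \<in> carrier L; y \<in> carrier L\<rbrakk> \<Longrightarrow>
      x \<otimes>\<^bsub>L\<^esub> (c \<odot>\<^bsub>L\<^esub> y) = c \<odot>\<^bsub>L\<^esub> (x \<otimes>\<^bsub>L\<^esub> y)"
  and bracket_self:
    "x \<in> carrier L \<Longrightarrow> x \<otimes>\<^bsub>L\<^esub> x = \<zero>\<^bsub>L\<^esub>"
  and jacobi:
    "\<lbrakk>x \<in> carrier L; y \<in> carrier L; z \<in> carrier L\<rbrakk> \<Longrightarrow>
      x \<otimes>\<^bsub>L\<^esub> (y \<otimes>\<^bsub>L\<^esub> z) \<oplus>\<^bsub>L\<^esub> y \<otimes>\<^bsub>L\<^esub> (z \<otimes>\<^bsub>L\<^esub> x) \<oplus>\<^bsub>L\<^esub> z \<otimes>\<^bsub>L\<^esub> (x \<otimes>\<^bsub>L\<^esub> y) = \<zero>\<^bsub>L\<^esub>"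

locale lie_algebra_hom = L?: lie_algebra R L + L'?: lie_algebra R L'
    for R (structure) and L (structure) and L' (structure) +
  fixes h
  assumes hom_closed: "x \<in> carrier L \<Longrightarrow> h x \<in> carrier L'"
  and hom_add:
    "\<lbrakk>x \<in> carrier L; y \<in> carrier L\<rbrakk> \<Longrightarrow> h (x \<oplus>\<^bsub>L\<^esub> y) = h x \<oplus>\<^bsub>L'\<^esub> h y"
  and hom_smult:
    "\<lbrakk>c \<in> carrier R; x \<in> carrier L\<rbrakk> \<Longrightarrow> h (c \<odot>\<^bsub>L\<^esub> x) = c \<odot>\<^bsub>L'\<^esub> h x"
  and hom_bracket:
    "\<lbrakk>x \<in> carrier L; y \<in> carrier L\<rbrakk> \<Longrightarrow> h (x \<otimes>\<^bsub>L\<^esub> y) = h x \<otimes>\<^bsub>L'\<^esub> h y"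

text \<open>
  The quotient of a Lie algebra by an ideal, built from cosets in the same way as \<open>FactRing\<close>;
  in particular \<open>rcoset_mult\<close> is the bracket induced on cosets.
\<close>

definition lie_quot :: "('c, 'g, 'm) module_scheme \<Rightarrow> 'g set \<Rightarrow> ('c, 'g set) module"
  where "lie_quot L I =
    \<lparr>carrier = a_rcosets\<^bsub>L\<^esub> I, mult = rcoset_mult L I, one = undefined,
     zero = I, add = set_add L,
     smult = (\<lambda>c X. \<Union>x\<in>X. I +>\<^bsub>L\<^esub> (c \<odot>\<^bsub>L\<^esub> x))\<rparr>"

text \<open>
  Maps from \<open>A\<close> to itself are extensional functions on the carrier, so that two of them are equal
  iff they agree on the carrier.
\<close>

definition Der :: "('c, 'r) ring_scheme \<Rightarrow> ('c, 'a, 'm) module_scheme \<Rightarrow> ('a \<Rightarrow> 'a) set"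
  where "Der R A = {f \<in> carrier A \<rightarrow>\<^sub>E carrier A.
    (\<forall>x\<in>carrier A. \<forall>y\<in>carrier A. f (x \<oplus>\<^bsub>A\<^esub> y) = f x \<oplus>\<^bsub>A\<^esub> f y) \<and>
    (\<forall>c\<in>carrier R. \<forall>x\<in>carrier A. f (c \<odot>\<^bsub>A\<^esub> x) = c \<odot>\<^bsub>A\<^esub> f x) \<and>
    (\<forall>x\<in>carrier A. \<forall>y\<in>carrier A. f (x \<otimes>\<^bsub>A\<^esub> y) = f x \<otimes>\<^bsub>A\<^esub> y \<oplus>\<^bsub>A\<^esub> x \<otimes>\<^bsub>A\<^esub> f y)}"

definition inner_der :: "('c, 'a, 'm) module_scheme \<Rightarrow> 'a \<Rightarrow> ('a \<Rightarrow> 'a)"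
  where "inner_der A a = (\<lambda>x\<in>carrier A. a \<otimes>\<^bsub>A\<^esub> x \<ominus>\<^bsub>A\<^esub> x \<otimes>\<^bsub>A\<^esub> a)"

definition Inn :: "('c, 'a, 'm) module_scheme \<Rightarrow> ('a \<Rightarrow> 'a) set"
  where "Inn A = inner_der A ` carrier A"

text \<open>Compatibility with the left and right actions of \<open>B\<close>; additivity is part of \<open>Der\<close>.\<close>

definition bimodule_compatible ::
    "('c, 'a, 'm) module_scheme \<Rightarrow> 'a set \<Rightarrow> ('a \<Rightarrow> 'a) \<Rightarrow> bool"
  where "bimodule_compatible A B f \<longleftrightarrow>
    (\<forall>b\<in>B. \<forall>x\<in>carrier A. f (b \<otimes>\<^bsub>A\<^esub> x) = b \<otimes>\<^bsub>A\<^esub> f x \<and> f (x \<otimes>\<^bsub>A\<^esub> b) = f x \<otimes>\<^bsub>A\<^esub> b)"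

definition Der_rel ::
    "('c, 'r) ring_scheme \<Rightarrow> ('c, 'a, 'm) module_scheme \<Rightarrow> 'a set \<Rightarrow> ('a \<Rightarrow> 'a) set"
  where "Der_rel R A B = {f \<in> Der R A. bimodule_compatible A B f}"

definition Inn_rel :: "('c, 'a, 'm) module_scheme \<Rightarrow> 'a set \<Rightarrow> ('a \<Rightarrow> 'a) set"
  where "Inn_rel A B = {f \<in> Inn A. bimodule_compatible A B f}"

definition Der_lie ::
    "('c, 'r) ring_scheme \<Rightarrow> ('c, 'a, 'm) module_scheme \<Rightarrow> ('c, 'a \<Rightarrow> 'a) module"
  where "Der_lie R A =
    \<lparr>carrier = Der R A,
     mult = (\<lambda>f g. \<lambda>x\<in>carrier A. f (g x) \<ominus>\<^bsub>A\<^esub> g (f x)),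
     one = undefined,
     zero = (\<lambda>x\<in>carrier A. \<zero>\<^bsub>A\<^esub>),
     add = (\<lambda>f g. \<lambda>x\<in>carrier A. f x \<oplus>\<^bsub>A\<^esub> g x),
     smult = (\<lambda>c f. \<lambda>x\<in>carrier A. c \<odot>\<^bsub>A\<^esub> f x)\<rparr>"

definition Der_rel_lie ::
    "('c, 'r) ring_scheme \<Rightarrow> ('c, 'a, 'm) module_scheme \<Rightarrow> 'a set \<Rightarrow> ('c, 'a \<Rightarrow> 'a) module"
  where "Der_rel_lie R A B = (Der_lie R A)\<lparr>carrier := Der_rel R A B\<rparr>"

definition HH1 ::
    "('c, 'r) ring_scheme \<Rightarrow> ('c, 'a, 'm) module_scheme \<Rightarrow> ('c, ('a \<Rightarrow> 'a) set) module"
  where "HH1 R A = lie_quot (Der_lie R A) (Inn A)"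

definition HH1_rel ::
    "('c, 'r) ring_scheme \<Rightarrow> ('c, 'a, 'm) module_scheme \<Rightarrow> 'a set \<Rightarrow> ('c, ('a \<Rightarrow> 'a) set) module"
  where "HH1_rel R A B = lie_quot (Der_rel_lie R A B) (Inn_rel A B)"

end

theory Submission
  imports Defs
begin

text \<open>
  Being inner is a condition on a derivation \<open>A \<rightarrow> A\<close> that does not mention \<open>B\<close>, so
  \<open>Inn_rel A B = Inn A \<inter> Der_rel k A B\<close>. Since \<open>Der_rel k A B\<close> is a Lie subalgebra of
  \<open>Der k A\<close> and \<open>Inn A\<close> is an ideal, by \<open>[f, inner_der a] = inner_der (f a)\<close>, the map is the
  embedding \<open>S / (I \<inter> S) \<rightarrow> L / I\<close> of the second isomorphism theorem for Lie algebras.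
\<close>

section \<open>Quotients of Lie algebras\<close>

context lie_algebra
begin

text \<open>Polarization: in the expansion of \<open>[x + y, x + y] = 0\<close> the squares of
  \<open>x\<close> and \<open>y\<close> vanish, and the two mixed brackets must cancel.\<close>

lemma bracket_anticomm:
  assumes x: "x \<in> carrier L" and y: "y \<in> carrier L"
  shows "x \<otimes>\<^bsub>L\<^esub> y = \<ominus>\<^bsub>L\<^esub> (y \<otimes>\<^bsub>L\<^esub> x)"
proof -
  have "\<zero>\<^bsub>L\<^esub> = (x \<oplus>\<^bsub>L\<^esub> y) \<otimes>\<^bsub>L\<^esub> (x \<oplus>\<^bsub>L\<^esub> y)"
    using x y by (simp add: bracket_self)
  also have "\<dots> = x \<otimes>\<^bsub>L\<^esub> y \<oplus>\<^bsub>L\<^esub> y \<otimes>\<^bsub>L\<^esub> x"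
    using x y by (simp add: bracket_add_left bracket_add_right bracket_self [OF x] bracket_self [OF y]
        bracket_closed M.a_comm)
  finally show ?thesis
    using x y by (metis M.minus_equality bracket_closed)
qed

end

text \<open>Absorption is demanded on one side only. The other side, \<open>ideal_bracket\<close>,
  follows from anticommutativity because a submodule is closed under negation.\<close>

locale lie_ideal = lie_algebra R L for I and R (structure) and L (structure) +
  assumes submod: "submodule I R L"
  and bracket_ideal: "\<lbrakk>x \<in> carrier L; i \<in> I\<rbrakk> \<Longrightarrow> x \<otimes>\<^bsub>L\<^esub> i \<in> I"
begin

sublocale abelian_subgroup I L
  by (intro abelian_subgroupI3 additive_subgroupI submodule.axioms(1) [OF submod])
    (rule M.abelian_group_axioms)

lemma smult_ideal: "\<lbrakk>c \<in> carrier R; i \<in> I\<rbrakk> \<Longrightarrow> c \<odot>\<^bsub>L\<^esub> i \<in> I"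
  using submodule.smult_closed [OF submod] by blast

lemma ideal_bracket: "\<lbrakk>i \<in> I; x \<in> carrier L\<rbrakk> \<Longrightarrow> i \<otimes>\<^bsub>L\<^esub> x \<in> I"
  using bracket_anticomm [of i x] bracket_ideal [of x i] a_subset by auto

lemma rcos_add_left: "\<lbrakk>i \<in> I; z \<in> carrier L\<rbrakk> \<Longrightarrow> I +>\<^bsub>L\<^esub> (i \<oplus>\<^bsub>L\<^esub> z) = I +>\<^bsub>L\<^esub> z"
  using a_repr_independence [of "i \<oplus>\<^bsub>L\<^esub> z" I z] a_rcosI a_subset a_subgroup by metis

lemma mem_rcosE:
  assumes "x' \<in> I +>\<^bsub>L\<^esub> x"
  obtains i where "i \<in> I" "x' = i \<oplus>\<^bsub>L\<^esub> x"
  using assms by (auto simp: a_r_coset_def')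

text \<open>This is what makes the bracket on cosets well defined: in \<open>[i + x, j + y]\<close>
  every term except \<open>[x, y]\<close> has an entry from the ideal and is absorbed.\<close>

lemma rcos_bracket_cong:
  assumes x: "x \<in> carrier L" and y: "y \<in> carrier L"
    and x': "x' \<in> I +>\<^bsub>L\<^esub> x" and y': "y' \<in> I +>\<^bsub>L\<^esub> y"
  shows "I +>\<^bsub>L\<^esub> (x' \<otimes>\<^bsub>L\<^esub> y') = I +>\<^bsub>L\<^esub> (x \<otimes>\<^bsub>L\<^esub> y)"
proof -
  obtain i where i: "i \<in> I" "x' = i \<oplus>\<^bsub>L\<^esub> x" using x' by (rule mem_rcosE)
  obtain j where j: "j \<in> I" "y' = j \<oplus>\<^bsub>L\<^esub> y" using y' by (rule mem_rcosE)
  have ij: "i \<in> carrier L" "j \<in> carrier L" using i j a_subset by auto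
  have "x' \<otimes>\<^bsub>L\<^esub> y' = i \<otimes>\<^bsub>L\<^esub> (j \<oplus>\<^bsub>L\<^esub> y) \<oplus>\<^bsub>L\<^esub> (x \<otimes>\<^bsub>L\<^esub> j \<oplus>\<^bsub>L\<^esub> x \<otimes>\<^bsub>L\<^esub> y)"
    using i j x y ij by (simp add: bracket_add_left bracket_add_right [of x])
  moreover have "i \<otimes>\<^bsub>L\<^esub> (j \<oplus>\<^bsub>L\<^esub> y) \<in> I" "x \<otimes>\<^bsub>L\<^esub> j \<in> I"
    using i j x y ij by (auto intro: ideal_bracket bracket_ideal)
  ultimately show ?thesis
    using x y ij by (simp add: rcos_add_left bracket_closed)
qed

lemma rcos_smult_cong:
  assumes c: "c \<in> carrier R" and x: "x \<in> carrier L" and x': "x' \<in> I +>\<^bsub>L\<^esub> x"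
  shows "I +>\<^bsub>L\<^esub> (c \<odot>\<^bsub>L\<^esub> x') = I +>\<^bsub>L\<^esub> (c \<odot>\<^bsub>L\<^esub> x)"
proof -
  obtain i where i: "i \<in> I" "x' = i \<oplus>\<^bsub>L\<^esub> x" using x' by (rule mem_rcosE)
  then show ?thesis
    using c x a_subset by (simp add: smult_r_distr rcos_add_left smult_ideal subset_iff)
qed

text \<open>\<open>rcoset_mult\<close> is a union over all pairs of representatives. By
  \<open>rcos_bracket_cong\<close> its members coincide, and there is at least one since
  \<open>x\<close> and \<open>y\<close> lie in their own cosets.\<close>

lemma rcos_bracket:
  assumes x: "x \<in> carrier L" and y: "y \<in> carrier L"
  shows "rcoset_mult L I (I +>\<^bsub>L\<^esub> x) (I +>\<^bsub>L\<^esub> y) = I +>\<^bsub>L\<^esub> (x \<otimes>\<^bsub>L\<^esub> y)"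
  unfolding rcoset_mult_def
  using rcos_bracket_cong [OF x y] a_rcos_self [OF x] a_rcos_self [OF y] by blast

lemma rcos_smult:
  assumes c: "c \<in> carrier R" and x: "x \<in> carrier L"
  shows "(\<Union>z\<in>I +>\<^bsub>L\<^esub> x. I +>\<^bsub>L\<^esub> (c \<odot>\<^bsub>L\<^esub> z)) = I +>\<^bsub>L\<^esub> (c \<odot>\<^bsub>L\<^esub> x)"
  using rcos_smult_cong [OF c x] a_rcos_self [OF x] by blast

section \<open>The quotient of a Lie algebra by an ideal\<close>

lemma carrier_lie_quot: "carrier (lie_quot L I) = (\<lambda>x. I +>\<^bsub>L\<^esub> x) ` carrier L"
  by (auto simp: lie_quot_def A_RCOSETS_def')

text \<open>The zero is written as a coset of zero so that all quotient operations act on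
  representatives in the same form. Each axiom of the quotient then reduces to the same axiom in
  \<open>L\<close>.\<close>

lemma zero_lie_quot: "\<zero>\<^bsub>lie_quot L I\<^esub> = I +>\<^bsub>L\<^esub> \<zero>\<^bsub>L\<^esub>"
  using a_subset by (simp add: lie_quot_def)

lemma add_lie_quot:
  "\<lbrakk>x \<in> carrier L; y \<in> carrier L\<rbrakk> \<Longrightarrow>
    (I +>\<^bsub>L\<^esub> x) \<oplus>\<^bsub>lie_quot L I\<^esub> (I +>\<^bsub>L\<^esub> y) = I +>\<^bsub>L\<^esub> (x \<oplus>\<^bsub>L\<^esub> y)"
  by (simp add: lie_quot_def a_rcos_sum)

lemma mult_lie_quot:
  "\<lbrakk>x \<in> carrier L; y \<in> carrier L\<rbrakk> \<Longrightarrow>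
    (I +>\<^bsub>L\<^esub> x) \<otimes>\<^bsub>lie_quot L I\<^esub> (I +>\<^bsub>L\<^esub> y) = I +>\<^bsub>L\<^esub> (x \<otimes>\<^bsub>L\<^esub> y)"
  by (simp add: lie_quot_def rcos_bracket)

lemma smult_lie_quot:
  "\<lbrakk>c \<in> carrier R; x \<in> carrier L\<rbrakk> \<Longrightarrow>
    c \<odot>\<^bsub>lie_quot L I\<^esub> (I +>\<^bsub>L\<^esub> x) = I +>\<^bsub>L\<^esub> (c \<odot>\<^bsub>L\<^esub> x)"
  by (simp add: lie_quot_def rcos_smult)

lemmas lie_quot_simps =
  carrier_lie_quot zero_lie_quot add_lie_quot mult_lie_quot smult_lie_quot

lemma lie_quot_abelian_group: "abelian_group (lie_quot L I)"
proof (rule abelian_groupI)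
  fix X assume "X \<in> carrier (lie_quot L I)"
  then obtain x where x: "x \<in> carrier L" "X = I +>\<^bsub>L\<^esub> x" by (auto simp: lie_quot_simps)
  then have "(I +>\<^bsub>L\<^esub> (\<ominus>\<^bsub>L\<^esub> x)) \<oplus>\<^bsub>lie_quot L I\<^esub> X = \<zero>\<^bsub>lie_quot L I\<^esub>"
    by (simp add: lie_quot_simps M.l_neg)
  then show "\<exists>Y\<in>carrier (lie_quot L I). Y \<oplus>\<^bsub>lie_quot L I\<^esub> X = \<zero>\<^bsub>lie_quot L I\<^esub>"
    using x by (auto simp: carrier_lie_quot)
qed (auto simp: lie_quot_simps M.a_ac)

lemma lie_quot_module: "module R (lie_quot L I)"
  by (rule moduleI [OF R.is_cring lie_quot_abelian_group])
    (auto simp: lie_quot_simps smult_l_distr smult_r_distr smult_assoc1)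

lemma lie_quot_lie_algebra: "lie_algebra R (lie_quot L I)"
  by (intro lie_algebra.intro lie_quot_module lie_algebra_axioms.intro)
    (auto simp: lie_quot_simps bracket_closed bracket_add_left bracket_add_right
      bracket_smult_left bracket_smult_right bracket_self jacobi)

end

section \<open>Lie subalgebras and the embedding of the second isomorphism theorem\<close>

definition lie_subalgebra ::
    "'g set \<Rightarrow> ('c, 'r) ring_scheme \<Rightarrow> ('c, 'g, 'm) module_scheme \<Rightarrow> bool"
  where "lie_subalgebra S R L \<longleftrightarrow> submodule S R L \<and> (\<forall>x\<in>S. \<forall>y\<in>S. x \<otimes>\<^bsub>L\<^esub> y \<in> S)"

lemma (in lie_algebra) lie_subalgebra_is_lie_algebra:
  assumes "lie_subalgebra S R L"
  shows "lie_algebra R (L\<lparr>carrier := S\<rparr>)"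
proof -
  have S: "submodule S R L" and closed: "\<And>x y. \<lbrakk>x \<in> S; y \<in> S\<rbrakk> \<Longrightarrow> x \<otimes>\<^bsub>L\<^esub> y \<in> S"
    using assms by (auto simp: lie_subalgebra_def)
  have sub: "x \<in> carrier L" if "x \<in> S" for x
    using submoduleE(1) [OF S] that by blast
  show ?thesis
    by (intro lie_algebra.intro lie_algebra_axioms.intro
        submodule.submodule_is_module [OF S module_axioms])
      (auto simp: sub closed bracket_add_left bracket_add_right
        bracket_smult_left bracket_smult_right bracket_self jacobi)
qed

lemma (in lie_ideal) inter_lie_subalgebra:
  assumes "lie_subalgebra S R L"
  shows "lie_ideal (I \<inter> S) R (L\<lparr>carrier := S\<rparr>)"
proof -
  have S: "submodule S R L" and closed: "\<And>x y. \<lbrakk>x \<in> S; y \<in> S\<rbrakk> \<Longrightarrow> x \<otimes>\<^bsub>L\<^esub> y \<in> S"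
    using assms by (auto simp: lie_subalgebra_def)
  interpret S: lie_algebra R "L\<lparr>carrier := S\<rparr>"
    using assms by (rule lie_subalgebra_is_lie_algebra)
  have sub: "x \<in> carrier L" if "x \<in> S" for x
    using submoduleE(1) [OF S] that by blast
  have "submodule (I \<inter> S) R L"
    using submoduleE [OF S] submoduleE [OF submod] zero_closed
      subgroup.one_closed [OF submodule.axioms(1) [OF S]]
    by (intro submoduleI) auto
  \<comment> \<open>Passing from submodule of \<open>L\<close> to submodule of \<open>S\<close> goes
    through the intersection as a module in its own right, a notion that does not depend on the
    ambient module.\<close>
  then have "module R (L\<lparr>carrier := I \<inter> S\<rparr>)"
    using module_axioms by (rule submodule.submodule_is_module)
  then have "submodule (I \<inter> S) R (L\<lparr>carrier := S\<rparr>)"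
    by (intro S.module_incl_imp_submodule) auto
  then show ?thesis
    by (intro lie_ideal.intro S.lie_algebra_axioms lie_ideal_axioms.intro)
      (simp_all add: sub closed bracket_ideal)
qed

text \<open>The embedding sends a coset of \<open>I \<inter> S\<close> to the unique coset of \<open>I\<close> containing it.\<close>

lemma (in lie_ideal) lie_quot_inter_embedding:
  assumes sa: "lie_subalgebra S R L"
  defines "LS \<equiv> L\<lparr>carrier := S\<rparr>"
  shows "\<exists>\<iota>. lie_algebra_hom R (lie_quot LS (I \<inter> S)) (lie_quot L I) \<iota> \<and>
             inj_on \<iota> (carrier (lie_quot LS (I \<inter> S))) \<and>
             (\<forall>x\<in>S. \<iota> ((I \<inter> S) +>\<^bsub>LS\<^esub> x) = I +>\<^bsub>L\<^esub> x)"
proof -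
  interpret S: lie_ideal "I \<inter> S" R LS
    unfolding LS_def using sa by (rule inter_lie_subalgebra)
  have S: "submodule S R L" using sa by (simp add: lie_subalgebra_def)
  have sub: "x \<in> carrier L" if "x \<in> S" for x
    using submoduleE(1) [OF S] that by blast
  have LS: "carrier LS = S" "add LS = add L" "mult LS = mult L" "smult LS = smult L"
    by (simp_all add: LS_def)
  \<comment> \<open>The union avoids a choice of representatives: all elements of a coset of
    \<open>I \<inter> S\<close> determine the same coset of \<open>I\<close>, so the union is that
    single coset.\<close>
  define \<iota> where "\<iota> X = (\<Union>x\<in>X. I +>\<^bsub>L\<^esub> x)" for X
  have \<iota>: "\<iota> ((I \<inter> S) +>\<^bsub>LS\<^esub> x) = I +>\<^bsub>L\<^esub> x" if "x \<in> S" for x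
  proof -
    have "I +>\<^bsub>L\<^esub> z = I +>\<^bsub>L\<^esub> x" if "z \<in> (I \<inter> S) +>\<^bsub>LS\<^esub> x" for z
      using that \<open>x \<in> S\<close> sub by (auto elim!: S.mem_rcosE simp: LS rcos_add_left)
    then show ?thesis
      using S.a_rcos_self [of x] that unfolding \<iota>_def LS by blast
  qed
  have closed: "x \<oplus>\<^bsub>L\<^esub> y \<in> S" "x \<otimes>\<^bsub>L\<^esub> y \<in> S" if "x \<in> S" "y \<in> S" for x y
    using that sa submoduleE(5) [OF S] by (auto simp: lie_subalgebra_def)
  have closed_smult: "c \<odot>\<^bsub>L\<^esub> x \<in> S" if "c \<in> carrier R" "x \<in> S" for c x
    using that by (rule submoduleE(4) [OF S])
  have "lie_algebra_hom R (lie_quot LS (I \<inter> S)) (lie_quot L I) \<iota>"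
    by (intro lie_algebra_hom.intro lie_algebra_hom_axioms.intro
        S.lie_quot_lie_algebra lie_quot_lie_algebra)
      (auto simp: S.lie_quot_simps lie_quot_simps \<iota> sub LS closed closed_smult)
  moreover have "inj_on \<iota> (carrier (lie_quot LS (I \<inter> S)))"
  proof (rule inj_onI)
    fix X Y assume "X \<in> carrier (lie_quot LS (I \<inter> S))" "Y \<in> carrier (lie_quot LS (I \<inter> S))"
      and eq: "\<iota> X = \<iota> Y"
    then obtain x y where x: "x \<in> S" "X = (I \<inter> S) +>\<^bsub>LS\<^esub> x" and y: "y \<in> S" "Y = (I \<inter> S) +>\<^bsub>LS\<^esub> y"
      by (auto simp: S.carrier_lie_quot LS)
    have "x \<in> I +>\<^bsub>L\<^esub> y"
      using eq x y a_rcos_self [OF sub [OF x(1)]] by (simp add: \<iota>)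
    then obtain i where i: "i \<in> I" "x = i \<oplus>\<^bsub>L\<^esub> y" by (rule mem_rcosE)
    \<comment> \<open>Equal images make \<open>x\<close> and \<open>y\<close> differ by some
      \<open>i\<close> in \<open>I\<close>. Since \<open>i\<close> is the difference of two elements
      of \<open>S\<close>, it lies in \<open>I \<inter> S\<close>, so the cosets in \<open>S\<close>
      already agree.\<close>
    then have "i = x \<oplus>\<^bsub>L\<^esub> \<ominus>\<^bsub>L\<^esub> y"
      using sub y a_subset by (simp add: M.a_assoc M.r_neg subset_iff)
    then have "i \<in> I \<inter> S"
      using i x y submoduleE(5) [OF S x(1) submoduleE(3) [OF S y(1)]] by simp
    then show "X = Y"
      using S.rcos_add_left [of i y] x y i by (simp add: LS)
  qed
  ultimately show ?thesis
    using \<iota> by blast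
qed

section \<open>The Lie algebra of derivations\<close>

context ring
begin

text \<open>Regroups the terms when the commutator of maps is expanded at a sum in one
  argument.\<close>

lemma add_diff_add:
  assumes "p \<in> carrier R" "q \<in> carrier R" "r \<in> carrier R" "s \<in> carrier R"
  shows "(p \<oplus> q) \<ominus> (r \<oplus> s) = (p \<ominus> r) \<oplus> (q \<ominus> s)"
  using assms by algebra

lemma commutator_add:
  assumes "x \<in> carrier R" "y \<in> carrier R" "z \<in> carrier R"
  shows "(x \<oplus> y) \<otimes> z \<ominus> z \<otimes> (x \<oplus> y) = (x \<otimes> z \<ominus> z \<otimes> x) \<oplus> (y \<otimes> z \<ominus> z \<otimes> y)"
  using assms by algebra

text \<open>The product rule for \<open>inner_der\<close>: adding and subtracting
  \<open>y \<otimes> x \<otimes> z\<close> splits the commutator with a product.\<close>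

lemma commutator_Leibniz:
  assumes "x \<in> carrier R" "y \<in> carrier R" "z \<in> carrier R"
  shows "x \<otimes> (y \<otimes> z) \<ominus> (y \<otimes> z) \<otimes> x =
    (x \<otimes> y \<ominus> y \<otimes> x) \<otimes> z \<oplus> y \<otimes> (x \<otimes> z \<ominus> z \<otimes> x)"
  using assms by algebra

text \<open>The mixed terms \<open>u, v\<close> of the two second-order Leibniz expansions cancel.\<close>

lemma second_order_Leibniz:
  assumes "p \<in> carrier R" "q \<in> carrier R" "r \<in> carrier R" "s \<in> carrier R"
    "u \<in> carrier R" "v \<in> carrier R" "x \<in> carrier R" "y \<in> carrier R"
  shows "((p \<otimes> y \<oplus> u) \<oplus> (v \<oplus> x \<otimes> q)) \<ominus> ((r \<otimes> y \<oplus> v) \<oplus> (u \<oplus> x \<otimes> s)) =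
    (p \<ominus> r) \<otimes> y \<oplus> x \<otimes> (q \<ominus> s)"
  using assms by algebra

text \<open>With \<open>p = f a\<close> and \<open>q = f x\<close>, the left side is
  \<open>f\<close> applied to \<open>[a, x]\<close> minus \<open>[a, f x]\<close>, and the right
  side is \<open>[f a, x]\<close>. This is the pointwise form of
  \<open>[f, inner_der a] = inner_der (f a)\<close>.\<close>

lemma derivation_commutator:
  assumes "p \<in> carrier R" "q \<in> carrier R" "a \<in> carrier R" "x \<in> carrier R"
  shows "((p \<otimes> x \<oplus> a \<otimes> q) \<ominus> (q \<otimes> a \<oplus> x \<otimes> p)) \<ominus> (a \<otimes> q \<ominus> q \<otimes> a) = p \<otimes> x \<ominus> x \<otimes> p"
  using assms by algebra

text \<open>The six letters stand for the values of the six triple composites of three maps; in the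
  cyclic sum of nested commutators each occurs twice, with opposite signs.\<close>

lemma commutator_jacobi:
  assumes "a \<in> carrier R" "b \<in> carrier R" "c \<in> carrier R"
    "d \<in> carrier R" "e \<in> carrier R" "f \<in> carrier R"
  shows "((a \<ominus> b) \<ominus> (c \<ominus> d)) \<oplus> ((c \<ominus> e) \<ominus> (f \<ominus> b)) \<oplus> ((f \<ominus> d) \<ominus> (a \<ominus> e)) = \<zero>"
  using assms by algebra

end

section \<open>Closure of derivations under the Lie operations\<close>

context assoc_algebra
begin

lemma ring_algebra: "ring M"
  using assoc_algebra_axioms by (simp add: assoc_algebra_def)

lemma DerD:
  assumes "f \<in> Der R M"
  shows "f \<in> carrier M \<rightarrow>\<^sub>E carrier M"
    and "x \<in> carrier M \<Longrightarrow> f x \<in> carrier M"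
    and "\<lbrakk>x \<in> carrier M; y \<in> carrier M\<rbrakk> \<Longrightarrow> f (x \<oplus>\<^bsub>M\<^esub> y) = f x \<oplus>\<^bsub>M\<^esub> f y"
    and "\<lbrakk>c \<in> carrier R; x \<in> carrier M\<rbrakk> \<Longrightarrow> f (c \<odot>\<^bsub>M\<^esub> x) = c \<odot>\<^bsub>M\<^esub> f x"
    and "\<lbrakk>x \<in> carrier M; y \<in> carrier M\<rbrakk> \<Longrightarrow>
      f (x \<otimes>\<^bsub>M\<^esub> y) = f x \<otimes>\<^bsub>M\<^esub> y \<oplus>\<^bsub>M\<^esub> x \<otimes>\<^bsub>M\<^esub> f y"
  using assms by (auto simp: Der_def)

text \<open>Negation is multiplication by the scalar -1, so this is an instance of
  linearity.\<close>

lemma Der_minus: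
  assumes f: "f \<in> Der R M" and x: "x \<in> carrier M"
  shows "f (\<ominus>\<^bsub>M\<^esub> x) = \<ominus>\<^bsub>M\<^esub> f x"
proof -
  have minus: "(\<ominus>\<^bsub>R\<^esub> \<one>\<^bsub>R\<^esub>) \<odot>\<^bsub>M\<^esub> y = \<ominus>\<^bsub>M\<^esub> y" if "y \<in> carrier M" for y
    using that by (simp add: smult_l_minus)
  show ?thesis
    using DerD(4) [OF f, of "\<ominus>\<^bsub>R\<^esub> \<one>\<^bsub>R\<^esub>" x] DerD(2) [OF f] x by (simp add: minus)
qed

lemma Der_diff:
  "\<lbrakk>f \<in> Der R M; x \<in> carrier M; y \<in> carrier M\<rbrakk> \<Longrightarrow>
    f (x \<ominus>\<^bsub>M\<^esub> y) = f x \<ominus>\<^bsub>M\<^esub> f y"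
  by (simp add: M.minus_eq DerD Der_minus)

lemma smult_diff:
  "\<lbrakk>c \<in> carrier R; x \<in> carrier M; y \<in> carrier M\<rbrakk> \<Longrightarrow>
    c \<odot>\<^bsub>M\<^esub> (x \<ominus>\<^bsub>M\<^esub> y) = c \<odot>\<^bsub>M\<^esub> x \<ominus>\<^bsub>M\<^esub> c \<odot>\<^bsub>M\<^esub> y"
  by (simp add: M.minus_eq smult_r_distr smult_r_minus)

lemma smult_commute:
  "\<lbrakk>c \<in> carrier R; d \<in> carrier R; x \<in> carrier M\<rbrakk> \<Longrightarrow>
    c \<odot>\<^bsub>M\<^esub> (d \<odot>\<^bsub>M\<^esub> x) = d \<odot>\<^bsub>M\<^esub> (c \<odot>\<^bsub>M\<^esub> x)"
  by (simp add: smult_assoc1 [symmetric] R.m_comm)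

lemmas ring_expand = ring.ring_simprules [OF ring_algebra]

lemma Der_lie_simps:
  "carrier (Der_lie R M) = Der R M"
  "\<zero>\<^bsub>Der_lie R M\<^esub> = (\<lambda>x\<in>carrier M. \<zero>\<^bsub>M\<^esub>)"
  "f \<oplus>\<^bsub>Der_lie R M\<^esub> g = (\<lambda>x\<in>carrier M. f x \<oplus>\<^bsub>M\<^esub> g x)"
  "f \<otimes>\<^bsub>Der_lie R M\<^esub> g = (\<lambda>x\<in>carrier M. f (g x) \<ominus>\<^bsub>M\<^esub> g (f x))"
  "c \<odot>\<^bsub>Der_lie R M\<^esub> f = (\<lambda>x\<in>carrier M. c \<odot>\<^bsub>M\<^esub> f x)"
  by (simp_all add: Der_lie_def)

lemma Der_zero: "(\<lambda>x\<in>carrier M. \<zero>\<^bsub>M\<^esub>) \<in> Der R M"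
  by (auto simp: Der_def ring_expand)

lemma Der_add:
  assumes f: "f \<in> Der R M" and g: "g \<in> Der R M"
  shows "(\<lambda>x\<in>carrier M. f x \<oplus>\<^bsub>M\<^esub> g x) \<in> Der R M"
proof -
  note fg = DerD [OF f] DerD [OF g]
  show ?thesis
    unfolding Der_def mem_Collect_eq
    by (auto simp: fg(2-5,7-10) smult_r_distr ring_expand)
qed

lemma Der_smult:
  assumes c: "c \<in> carrier R" and f: "f \<in> Der R M"
  shows "(\<lambda>x\<in>carrier M. c \<odot>\<^bsub>M\<^esub> f x) \<in> Der R M"
proof -
  note f = DerD [OF f]
  show ?thesis
    unfolding Der_def mem_Collect_eq
    using c by (auto simp: f(2-5) smult_r_distr smult_commute smult_mult_left smult_mult_right
        ring_expand)
qed

lemma Der_bracket: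
  assumes f: "f \<in> Der R M" and g: "g \<in> Der R M"
  shows "(\<lambda>x\<in>carrier M. f (g x) \<ominus>\<^bsub>M\<^esub> g (f x)) \<in> Der R M"
proof -
  note fg = DerD [OF f] DerD [OF g]
  \<comment> \<open>The mixed terms are \<open>u = g x \<otimes> f y\<close> and
    \<open>v = f x \<otimes> g y\<close>; applying the two maps in the other order produces the same
    pair.\<close>
  have Leibniz: "f (g (x \<otimes>\<^bsub>M\<^esub> y)) \<ominus>\<^bsub>M\<^esub> g (f (x \<otimes>\<^bsub>M\<^esub> y)) =
      (f (g x) \<ominus>\<^bsub>M\<^esub> g (f x)) \<otimes>\<^bsub>M\<^esub> y \<oplus>\<^bsub>M\<^esub> x \<otimes>\<^bsub>M\<^esub> (f (g y) \<ominus>\<^bsub>M\<^esub> g (f y))"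
    if "x \<in> carrier M" "y \<in> carrier M" for x y
    using that ring.second_order_Leibniz [OF ring_algebra, of "f (g x)" "f (g y)" "g (f x)" "g (f y)"
        "g x \<otimes>\<^bsub>M\<^esub> f y" "f x \<otimes>\<^bsub>M\<^esub> g y" x y]
    by (simp add: fg(2-5,7-10) ring_expand(5))
  \<comment> \<open>The product rule is settled first, from \<open>Leibniz\<close> and with
    differences kept intact; linearity is then left to the full ring rules.\<close>
  show ?thesis
    unfolding Der_def mem_Collect_eq
    by (auto simp: fg(2-4,7-9) Leibniz ring_expand(5))
      (auto simp: fg(2-4,7-9) smult_r_distr smult_r_minus ring_expand)
qed

text \<open>The operations of \<open>Der_lie\<close> return restrictions to the carrier. Writing
  \<open>f\<close> itself as one reduces an equation between maps to a pointwise equation.\<close>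

lemma Der_restrict: "f \<in> Der R M \<Longrightarrow> (\<lambda>x\<in>carrier M. f x) = f"
  using DerD(1) by fastforce

section \<open>The Lie algebra axioms for derivations\<close>

lemma Der_lie_abelian_group: "abelian_group (Der_lie R M)"
proof (rule abelian_groupI)
  fix f assume "f \<in> carrier (Der_lie R M)"
  then have f: "f \<in> Der R M" by (simp add: Der_lie_simps)
  \<comment> \<open>The inverse is taken to be the scalar multiple of \<open>f\<close> by -1, so
    that \<open>Der_smult\<close> shows it to be a derivation.\<close>
  show "\<exists>g\<in>carrier (Der_lie R M). g \<oplus>\<^bsub>Der_lie R M\<^esub> f = \<zero>\<^bsub>Der_lie R M\<^esub>"
    using Der_smult [OF _ f, of "\<ominus>\<^bsub>R\<^esub> \<one>\<^bsub>R\<^esub>"] DerD(2) [OF f]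
    by (intro bexI [of _ "\<lambda>x\<in>carrier M. (\<ominus>\<^bsub>R\<^esub> \<one>\<^bsub>R\<^esub>) \<odot>\<^bsub>M\<^esub> f x"])
      (auto simp: Der_lie_simps smult_l_minus M.l_neg intro!: restrict_ext)
  show "\<zero>\<^bsub>Der_lie R M\<^esub> \<oplus>\<^bsub>Der_lie R M\<^esub> f = f"
    by (subst (2) Der_restrict [OF f, symmetric])
      (auto simp: Der_lie_simps DerD(2) [OF f] intro!: restrict_ext)
next
  fix f g h
  assume "f \<in> carrier (Der_lie R M)" "g \<in> carrier (Der_lie R M)" "h \<in> carrier (Der_lie R M)"
  then have D: "f x \<in> carrier M" "g x \<in> carrier M" "h x \<in> carrier M" if "x \<in> carrier M" for x
    using that by (simp_all add: Der_lie_simps DerD(2))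
  show "f \<oplus>\<^bsub>Der_lie R M\<^esub> g \<oplus>\<^bsub>Der_lie R M\<^esub> h =
      f \<oplus>\<^bsub>Der_lie R M\<^esub> (g \<oplus>\<^bsub>Der_lie R M\<^esub> h)"
    by (auto simp: Der_lie_simps D M.a_assoc intro!: restrict_ext)
next
  fix f g
  assume "f \<in> carrier (Der_lie R M)" "g \<in> carrier (Der_lie R M)"
  then have D: "f x \<in> carrier M" "g x \<in> carrier M" if "x \<in> carrier M" for x
    using that by (simp_all add: Der_lie_simps DerD(2))
  show "f \<oplus>\<^bsub>Der_lie R M\<^esub> g = g \<oplus>\<^bsub>Der_lie R M\<^esub> f"
    by (auto simp: Der_lie_simps D M.a_comm intro!: restrict_ext)
qed (auto simp: Der_lie_simps Der_zero Der_add)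

lemma Der_lie_module: "module R (Der_lie R M)"
proof (rule moduleI [OF R.is_cring Der_lie_abelian_group])
  fix f assume "f \<in> carrier (Der_lie R M)"
  then have f: "f \<in> Der R M" by (simp add: Der_lie_simps)
  show "\<one>\<^bsub>R\<^esub> \<odot>\<^bsub>Der_lie R M\<^esub> f = f"
    by (subst (2) Der_restrict [OF f, symmetric])
      (auto simp: Der_lie_simps DerD(2) [OF f] intro!: restrict_ext)
next
  fix c d f
  assume c: "c \<in> carrier R" and d: "d \<in> carrier R" and f: "f \<in> carrier (Der_lie R M)"
  then have D: "f x \<in> carrier M" if "x \<in> carrier M" for x
    using that by (simp add: Der_lie_simps DerD(2))
  show "(c \<oplus>\<^bsub>R\<^esub> d) \<odot>\<^bsub>Der_lie R M\<^esub> f =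
      c \<odot>\<^bsub>Der_lie R M\<^esub> f \<oplus>\<^bsub>Der_lie R M\<^esub> d \<odot>\<^bsub>Der_lie R M\<^esub> f"
    "(c \<otimes>\<^bsub>R\<^esub> d) \<odot>\<^bsub>Der_lie R M\<^esub> f =
      c \<odot>\<^bsub>Der_lie R M\<^esub> (d \<odot>\<^bsub>Der_lie R M\<^esub> f)"
    using c d by (auto simp: Der_lie_simps D smult_l_distr smult_assoc1 intro!: restrict_ext)
next
  fix c f g
  assume c: "c \<in> carrier R" and "f \<in> carrier (Der_lie R M)" "g \<in> carrier (Der_lie R M)"
  then have D: "f x \<in> carrier M" "g x \<in> carrier M" if "x \<in> carrier M" for x
    using that by (simp_all add: Der_lie_simps DerD(2))
  show "c \<odot>\<^bsub>Der_lie R M\<^esub> (f \<oplus>\<^bsub>Der_lie R M\<^esub> g) =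
      c \<odot>\<^bsub>Der_lie R M\<^esub> f \<oplus>\<^bsub>Der_lie R M\<^esub> c \<odot>\<^bsub>Der_lie R M\<^esub> g"
    using c by (auto simp: Der_lie_simps D smult_r_distr intro!: restrict_ext)
qed (auto simp: Der_lie_simps Der_smult)

lemma Der_lie_algebra: "lie_algebra R (Der_lie R M)"
proof (intro lie_algebra.intro Der_lie_module lie_algebra_axioms.intro)
  fix f g h
  assume "f \<in> carrier (Der_lie R M)" "g \<in> carrier (Der_lie R M)" "h \<in> carrier (Der_lie R M)"
  then have f: "f \<in> Der R M" and g: "g \<in> Der R M" and h: "h \<in> Der R M"
    by (simp_all add: Der_lie_simps)
  note D = DerD(2-4) [OF f] DerD(2-4) [OF g] DerD(2-4) [OF h]
    Der_diff [OF f] Der_diff [OF g] Der_diff [OF h]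
  show "(f \<oplus>\<^bsub>Der_lie R M\<^esub> g) \<otimes>\<^bsub>Der_lie R M\<^esub> h =
      f \<otimes>\<^bsub>Der_lie R M\<^esub> h \<oplus>\<^bsub>Der_lie R M\<^esub> g \<otimes>\<^bsub>Der_lie R M\<^esub> h"
    "f \<otimes>\<^bsub>Der_lie R M\<^esub> (g \<oplus>\<^bsub>Der_lie R M\<^esub> h) =
      f \<otimes>\<^bsub>Der_lie R M\<^esub> g \<oplus>\<^bsub>Der_lie R M\<^esub> f \<otimes>\<^bsub>Der_lie R M\<^esub> h"
    by (auto simp: Der_lie_simps D ring.add_diff_add [OF ring_algebra] intro!: restrict_ext)
  \<comment> \<open>\<open>Der_diff\<close> carries the outer map of each nested bracket past the
    inner difference, which produces the pattern of \<open>commutator_jacobi\<close>.\<close>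
  show "f \<otimes>\<^bsub>Der_lie R M\<^esub> (g \<otimes>\<^bsub>Der_lie R M\<^esub> h) \<oplus>\<^bsub>Der_lie R M\<^esub>
      g \<otimes>\<^bsub>Der_lie R M\<^esub> (h \<otimes>\<^bsub>Der_lie R M\<^esub> f) \<oplus>\<^bsub>Der_lie R M\<^esub>
      h \<otimes>\<^bsub>Der_lie R M\<^esub> (f \<otimes>\<^bsub>Der_lie R M\<^esub> g) = \<zero>\<^bsub>Der_lie R M\<^esub>"
    using ring.commutator_jacobi [OF ring_algebra]
    by (auto simp: Der_lie_simps D intro!: restrict_ext)
next
  fix c f g
  assume c: "c \<in> carrier R" and "f \<in> carrier (Der_lie R M)" "g \<in> carrier (Der_lie R M)"
  then have f: "f \<in> Der R M" and g: "g \<in> Der R M"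
    by (simp_all add: Der_lie_simps)
  note D = DerD(2,4) [OF f] DerD(2,4) [OF g]
  show "(c \<odot>\<^bsub>Der_lie R M\<^esub> f) \<otimes>\<^bsub>Der_lie R M\<^esub> g =
      c \<odot>\<^bsub>Der_lie R M\<^esub> (f \<otimes>\<^bsub>Der_lie R M\<^esub> g)"
    "f \<otimes>\<^bsub>Der_lie R M\<^esub> (c \<odot>\<^bsub>Der_lie R M\<^esub> g) =
      c \<odot>\<^bsub>Der_lie R M\<^esub> (f \<otimes>\<^bsub>Der_lie R M\<^esub> g)"
    using c by (auto simp: Der_lie_simps D smult_diff intro!: restrict_ext)
qed (auto simp: Der_lie_simps Der_bracket DerD(2) intro!: restrict_ext)

section \<open>Inner derivations and derivations relative to a subalgebra\<close>

lemma inner_der_Der: "a \<in> carrier M \<Longrightarrow> inner_der M a \<in> Der R M"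
  unfolding Der_def mem_Collect_eq inner_der_def
  by (auto simp: ring.commutator_Leibniz [OF ring_algebra] ring_expand(5))
    (auto simp: smult_r_distr smult_r_minus smult_mult_left smult_mult_right ring_expand)

text \<open>The submodule part rests on linearity of \<open>inner_der M a\<close> in
  \<open>a\<close>: sums and scalar multiples of inner derivations come from those of the elements
  inducing them.\<close>

lemma Inn_lie_ideal: "lie_ideal (Inn M) R (Der_lie R M)"
proof -
  interpret D: lie_algebra R "Der_lie R M" by (rule Der_lie_algebra)
  have closed_smult: "c \<odot>\<^bsub>Der_lie R M\<^esub> f \<in> Inn M"
    if c: "c \<in> carrier R" and f: "f \<in> Inn M" for c f
  proof -
    obtain a where a: "a \<in> carrier M" "f = inner_der M a" using f by (auto simp: Inn_def)
    have "c \<odot>\<^bsub>Der_lie R M\<^esub> f = inner_der M (c \<odot>\<^bsub>M\<^esub> a)"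
      using a c by (auto simp: Der_lie_simps inner_der_def smult_r_distr smult_r_minus smult_mult_left
          smult_mult_right ring_expand intro!: restrict_ext)
    then show ?thesis using a c by (simp add: Inn_def)
  qed
  have sub: "Inn M \<subseteq> carrier (Der_lie R M)"
    by (auto simp: Inn_def Der_lie_simps inner_der_Der)
  have "submodule (Inn M) R (Der_lie R M)"
  proof (rule D.submoduleI [OF sub])
    have "\<zero>\<^bsub>Der_lie R M\<^esub> = inner_der M \<zero>\<^bsub>M\<^esub>"
      by (auto simp: Der_lie_simps inner_der_def ring_expand intro!: restrict_ext)
    then show "\<zero>\<^bsub>Der_lie R M\<^esub> \<in> Inn M" by (simp add: Inn_def)
  next
    fix f assume f: "f \<in> Inn M"
    \<comment> \<open>The record \<open>Der_lie\<close> has no field for negation, so closure under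
      it is obtained from closure under the scalar -1.\<close>
    then have "\<ominus>\<^bsub>Der_lie R M\<^esub> f = (\<ominus>\<^bsub>R\<^esub> \<one>\<^bsub>R\<^esub>) \<odot>\<^bsub>Der_lie R M\<^esub> f"
      using sub by (auto simp: D.smult_l_minus)
    then show "\<ominus>\<^bsub>Der_lie R M\<^esub> f \<in> Inn M" using f by (simp add: closed_smult)
  next
    fix f g assume "f \<in> Inn M" "g \<in> Inn M"
    then obtain a b where ab: "a \<in> carrier M" "f = inner_der M a" "b \<in> carrier M" "g = inner_der M b"
      by (auto simp: Inn_def)
    have "f \<oplus>\<^bsub>Der_lie R M\<^esub> g = inner_der M (a \<oplus>\<^bsub>M\<^esub> b)"
      using ab by (auto simp: Der_lie_simps inner_der_def ring.commutator_add [OF ring_algebra]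
          intro!: restrict_ext)
    then show "f \<oplus>\<^bsub>Der_lie R M\<^esub> g \<in> Inn M" using ab by (simp add: Inn_def)
  qed (rule closed_smult)
  moreover have "f \<otimes>\<^bsub>Der_lie R M\<^esub> g \<in> Inn M"
    if fD: "f \<in> carrier (Der_lie R M)" and g: "g \<in> Inn M" for f g
  proof -
    have f: "f \<in> Der R M" using fD by (simp add: Der_lie_simps)
    obtain a where a: "a \<in> carrier M" "g = inner_der M a" using g by (auto simp: Inn_def)
    have "f \<otimes>\<^bsub>Der_lie R M\<^esub> g = inner_der M (f a)"
      using a DerD(2) [OF f] ring.derivation_commutator [OF ring_algebra]
      by (auto simp: Der_lie_simps inner_der_def DerD(5) [OF f] Der_diff [OF f] ring_expand(5)
          intro!: restrict_ext)
    then show ?thesis using a DerD(2) [OF f] by (simp add: Inn_def)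
  qed
  ultimately show ?thesis
    by (intro lie_ideal.intro D.lie_algebra_axioms lie_ideal_axioms.intro)
qed

text \<open>Maps commuting with left and right multiplication by elements of \<open>B\<close> are
  closed under composition and linear combination, hence under the commutator.\<close>

lemma Der_rel_lie_subalgebra:
  assumes B: "B \<subseteq> carrier M"
  shows "lie_subalgebra (Der_rel R M B) R (Der_lie R M)"
proof -
  interpret D: lie_algebra R "Der_lie R M" by (rule Der_lie_algebra)
  have sub: "b \<in> carrier M" if "b \<in> B" for b using that B by blast
  have closed_smult: "c \<odot>\<^bsub>Der_lie R M\<^esub> f \<in> Der_rel R M B"
    if "c \<in> carrier R" "f \<in> Der_rel R M B" for c f
    using that by (auto simp: Der_rel_def bimodule_compatible_def Der_lie_simps Der_smult DerD(2) sub
        smult_mult_left smult_mult_right ring_expand)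
  have "submodule (Der_rel R M B) R (Der_lie R M)"
  proof (rule D.submoduleI)
    show "Der_rel R M B \<subseteq> carrier (Der_lie R M)"
      by (auto simp: Der_rel_def Der_lie_simps)
    show "\<zero>\<^bsub>Der_lie R M\<^esub> \<in> Der_rel R M B"
      by (auto simp: Der_rel_def bimodule_compatible_def Der_lie_simps Der_zero sub ring_expand)
  next
    fix f assume f: "f \<in> Der_rel R M B"
    then have "\<ominus>\<^bsub>Der_lie R M\<^esub> f = (\<ominus>\<^bsub>R\<^esub> \<one>\<^bsub>R\<^esub>) \<odot>\<^bsub>Der_lie R M\<^esub> f"
      by (auto simp: D.smult_l_minus Der_rel_def Der_lie_simps(1))
    then show "\<ominus>\<^bsub>Der_lie R M\<^esub> f \<in> Der_rel R M B" using f by (simp add: closed_smult)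
  next
    fix f g assume "f \<in> Der_rel R M B" "g \<in> Der_rel R M B"
    then have f: "f \<in> Der R M" "bimodule_compatible M B f"
      and g: "g \<in> Der R M" "bimodule_compatible M B g"
      by (auto simp: Der_rel_def)
    then show "f \<oplus>\<^bsub>Der_lie R M\<^esub> g \<in> Der_rel R M B"
      using DerD(2) [OF f(1)] DerD(2) [OF g(1)]
      by (auto simp: Der_rel_def bimodule_compatible_def Der_lie_simps Der_add sub ring_expand)
  qed (rule closed_smult)
  moreover have "f \<otimes>\<^bsub>Der_lie R M\<^esub> g \<in> Der_rel R M B"
    if "f \<in> Der_rel R M B" "g \<in> Der_rel R M B" for f g
  proof -
    have f: "f \<in> Der R M" "bimodule_compatible M B f"
      and g: "g \<in> Der R M" "bimodule_compatible M B g"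
      using that by (auto simp: Der_rel_def)
    then show ?thesis
      using DerD(2) [OF f(1)] DerD(2) [OF g(1)] Der_bracket [OF f(1) g(1)]
      by (auto simp: Der_rel_def bimodule_compatible_def Der_lie_simps sub ring_expand)
  qed
  ultimately show ?thesis
    by (simp add: lie_subalgebra_def)
qed

text \<open>Brings the denominator of \<open>HH1_rel\<close> into the form
  \<open>I \<inter> S\<close> required by \<open>lie_quot_inter_embedding\<close>; it holds because
  inner derivations are derivations.\<close>

lemma Inn_rel_eq: "Inn_rel M B = Inn M \<inter> Der_rel R M B"
  by (auto simp: Inn_rel_def Der_rel_def Inn_def inner_der_Der)

end

theorem lemma4p1:
  fixes k :: "('c, 'r) ring_scheme"
    and A :: "('c, 'a, 'm) module_scheme"
    and B :: "'a set"
  assumes "field k"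
    and "assoc_algebra k A"
    and "is_subalgebra k A B"
  shows "\<exists>\<iota>. lie_algebra_hom k (HH1_rel k A B) (HH1 k A) \<iota> \<and>
             inj_on \<iota> (carrier (HH1_rel k A B)) \<and>
             (\<forall>f\<in>Der_rel k A B.
                \<iota> (Inn_rel A B +>\<^bsub>Der_rel_lie k A B\<^esub> f) = Inn A +>\<^bsub>Der_lie k A\<^esub> f)"
proof -
  interpret assoc_algebra k A by (rule assms(2))
  have "B \<subseteq> carrier A"
    using assms(3) subringE(1) by (auto simp: is_subalgebra_def)
  \<comment> \<open>Once unfolded, the goal is \<open>lie_quot_inter_embedding\<close> for the ideal
    \<open>Inn A\<close> and the subalgebra \<open>Der_rel k A B\<close> of
    \<open>Der_lie k A\<close>.\<close>
  then show ?thesis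
    unfolding HH1_rel_def HH1_def Der_rel_lie_def Inn_rel_eq
    by (intro lie_ideal.lie_quot_inter_embedding Inn_lie_ideal Der_rel_lie_subalgebra)
qed

end
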